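(* Let $\mathfrak F=(X,R,E)$ be a descriptive $\mathsf{MS4}$-frame. Then $\mathfrak F\models \mathsf{M^{+}Cas}$ iff, for any $E$-saturated clopen $U$, $x\in\operatorname{qmax}U$ implies $E(x)$ is flat.
   Context: A descriptive $\mathsf{MS4}$-frame is $(X,R,E)$ with $X$ a Stone space, $R$ a continuous quasi-order, $E$ a continuous equivalence relation, and $RE\subseteq ER$. Write $\square=\neg\lozenge\neg$, $\forall=\neg\exists\neg$, where $\lozenge$ is interpreted by $R$ and $\exists$ by $E$. $\mathsf{M^{+}Cas}=\square\forall(\square(\square p\to\square\forall p)\to\square\forall p)\to\square\forall p$ (here $\square\forall$ is the dual of the operator $\lozenge\exists$, whose dual relation is $Q=ER$). A set $A$ is flat if $xRy$ implies $yRx$ for all $x,y\in A$; $E$-saturated means a union of $E$-classes; $\operatorname{qmax}A=\{x\in A: xRy,\ y\in A\Rightarrow yRx\}$. *)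

theory Defs
  imports "HOL-Analysis.Analysis"
begin

definition stone_space :: "'a topology \<Rightarrow> bool" where
  "stone_space X \<longleftrightarrow> compact_space X \<and> Hausdorff_space X \<and> X dim_le 0"

definition clopenin :: "'a topology \<Rightarrow> 'a set \<Rightarrow> bool" where
  "clopenin X U \<longleftrightarrow> openin X U \<and> closedin X U"

text \<open>A relation is continuous if the induced map \<open>x \<mapsto> R(x)\<close> into the Vietoris space of closed
  subsets is well defined and continuous: each \<open>R(x)\<close> is closed, and the preimage
  \<open>R\<^sup>-\<^sup>1(U) = {x. \<exists>y\<in>U. x R y}\<close> of each clopen \<open>U\<close> is clopen.\<close>

definition continuous_rel :: "'a topology \<Rightarrow> 'a rel \<Rightarrow> bool" where
  "continuous_rel X R \<longleftrightarrow>
     R \<subseteq> topspace X \<times> topspace X \<and>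
     (\<forall>x \<in> topspace X. closedin X (R `` {x})) \<and>
     (\<forall>U. clopenin X U \<longrightarrow> clopenin X (R\<inverse> `` U))"

text \<open>In \<open>RE \<subseteq> ER\<close> relations compose from right to left (so that \<open>Q = ER\<close> is the dual relation of
  the operator \<open>\<diamond>\<exists>\<close>): \<open>x E y R z\<close> implies \<open>x R u E z\<close> for some \<open>u\<close>. The library's \<open>O\<close> composes from
  left to right, hence the reversed order below.\<close>

definition descriptive_ms4_frame :: "'a topology \<Rightarrow> 'a rel \<Rightarrow> 'a rel \<Rightarrow> bool" where
  "descriptive_ms4_frame X R E \<longleftrightarrow>
     stone_space X \<and>
     preorder_on (topspace X) R \<and> continuous_rel X R \<and>
     equiv (topspace X) E \<and> continuous_rel X E \<and>
     E O R \<subseteq> R O E"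

datatype ms4_formula =
    Var nat
  | Bot
  | Imp ms4_formula ms4_formula
  | Dia ms4_formula
  | Exists ms4_formula

definition Neg :: "ms4_formula \<Rightarrow> ms4_formula" where
  "Neg \<phi> = Imp \<phi> Bot"

definition Box :: "ms4_formula \<Rightarrow> ms4_formula" where
  "Box \<phi> = Neg (Dia (Neg \<phi>))"

definition Forall :: "ms4_formula \<Rightarrow> ms4_formula" where
  "Forall \<phi> = Neg (Exists (Neg \<phi>))"

primrec truth_set ::
    "'a topology \<Rightarrow> 'a rel \<Rightarrow> 'a rel \<Rightarrow> (nat \<Rightarrow> 'a set) \<Rightarrow> ms4_formula \<Rightarrow> 'a set" where
  "truth_set X R E v (Var n) = v n"
| "truth_set X R E v Bot = {}"
| "truth_set X R E v (Imp \<phi> \<psi>) = (topspace X - truth_set X R E v \<phi>) \<union> truth_set X R E v \<psi>"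
| "truth_set X R E v (Dia \<phi>) = R\<inverse> `` truth_set X R E v \<phi>"
| "truth_set X R E v (Exists \<phi>) = E\<inverse> `` truth_set X R E v \<phi>"

text \<open>On a descriptive frame only valuations by clopen sets are admissible.\<close>

definition frame_valid :: "'a topology \<Rightarrow> 'a rel \<Rightarrow> 'a rel \<Rightarrow> ms4_formula \<Rightarrow> bool" where
  "frame_valid X R E \<phi> \<longleftrightarrow>
     (\<forall>v. (\<forall>n. clopenin X (v n)) \<longrightarrow> truth_set X R E v \<phi> = topspace X)"

definition MpCas :: ms4_formula where
  "MpCas =
     (let p = Var 0; BA = (\<lambda>\<phi>. Box (Forall \<phi>))
      in Imp (BA (Imp (Box (Imp (Box p) (BA p))) (BA p))) (BA p))"

definition flat :: "'a rel \<Rightarrow> 'a set \<Rightarrow> bool" where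
  "flat R A \<longleftrightarrow> (\<forall>x\<in>A. \<forall>y\<in>A. (x, y) \<in> R \<longrightarrow> (y, x) \<in> R)"

definition saturated :: "'a topology \<Rightarrow> 'a rel \<Rightarrow> 'a set \<Rightarrow> bool" where
  "saturated X E U \<longleftrightarrow> (\<exists>\<C> \<subseteq> topspace X // E. U = \<Union>\<C>)"

definition qmax :: "'a rel \<Rightarrow> 'a set \<Rightarrow> 'a set" where
  "qmax R A = {x \<in> A. \<forall>y\<in>A. (x, y) \<in> R \<longrightarrow> (y, x) \<in> R}"

end

theory Submission
  imports Defs
begin

text \<open>Truth sets of \<open>\<box>\<forall>\<phi>\<close> are upsets for \<open>Q = ER\<close> and hence \<open>E\<close>-saturated. If \<open>M\<^sup>+Cas\<close> fails,
  subtracting the truth set of \<open>\<box>\<forall>p\<close> from that of the antecedent gives a nonempty saturated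
  clopen set \<open>U\<close>; by compactness it has quasi-maximal points. Every point of \<open>U\<close> sees a point of
  \<open>U\<close> satisfying \<open>\<box>p\<close>, so all its quasi-maximal points satisfy \<open>\<box>p\<close>. Flatness of
  their \<open>E\<close>-classes makes the whole classes quasi-maximal, so they satisfy \<open>\<box>\<forall>p\<close>, a contradiction.

  Conversely, let \<open>x \<in> qmax U\<close> with \<open>E(x)\<close> not flat, say \<open>y R z\<close> but not \<open>z R y\<close> in \<open>E(x)\<close>.
  Separate \<open>z\<close> from \<open>y\<close> by a clopen upset \<open>D\<close>. Letting \<open>p\<close> be false exactly at the points of
  \<open>U - D\<close> that see \<open>D \<inter> U\<close> refutes \<open>M\<^sup>+Cas\<close> at \<open>x\<close>.\<close>

section \<open>Clopen sets and quasi-maximal points in Stone spaces\<close>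

lemma clopenin_Diff: "clopenin X A \<Longrightarrow> clopenin X B \<Longrightarrow> clopenin X (A - B)"
  by (auto simp: clopenin_def)

lemma clopenin_Int: "clopenin X A \<Longrightarrow> clopenin X B \<Longrightarrow> clopenin X (A \<inter> B)"
  by (auto simp: clopenin_def)

lemma clopenin_Un: "clopenin X A \<Longrightarrow> clopenin X B \<Longrightarrow> clopenin X (A \<union> B)"
  by (auto simp: clopenin_def)

lemma clopenin_topspace: "clopenin X (topspace X)"
  by (auto simp: clopenin_def)

lemma clopenin_subset: "clopenin X A \<Longrightarrow> A \<subseteq> topspace X"
  by (simp add: clopenin_def openin_subset)

lemma stone_space_separate:
  assumes "stone_space X" "closedin X K" "y \<in> topspace X" "y \<notin> K"
  obtains V where "clopenin X V" "y \<in> V" "V \<inter> K = {}"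
proof -
  have "neighbourhood_base_of (\<lambda>U. closedin X U \<and> openin X U) X"
    using assms(1) by (simp add: stone_space_def dimension_le_0_neighbourhood_base_of_clopen)
  moreover have "openin X (topspace X - K)" "y \<in> topspace X - K"
    using assms by auto
  ultimately obtain W V where "openin X W" "closedin X V" "openin X V"
      "y \<in> W" "W \<subseteq> V" "V \<subseteq> topspace X - K"
    unfolding neighbourhood_base_of by meson
  then show thesis
    using that[of V] by (auto simp: clopenin_def)
qed

text \<open>Zorn's lemma on the closed sets \<open>up c\<close>, looking for a minimal one:
  compactness gives a chain of them a common point, whose own \<open>up\<close> lies inside every
  member.\<close>

lemma exists_qmax_above:
  assumes comp: "compact_space X" and pre: "preorder_on (topspace X) R"
    and cl: "\<And>x. x \<in> topspace X \<Longrightarrow> closedin X (R `` {x})"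
    and F: "closedin X F" and x: "x \<in> F"
  obtains y where "(x, y) \<in> R" "y \<in> qmax R F"
proof -
  have refl: "(a, a) \<in> R" if "a \<in> topspace X" for a
    using pre that by (auto simp: preorder_on_def refl_on_def)
  have trans: "(a, c) \<in> R" if "(a, b) \<in> R" "(b, c) \<in> R" for a b c
    using pre that by (auto simp: preorder_on_def dest: transD)
  have FX: "F \<subseteq> topspace X"
    using F closedin_subset by blast
  define up where "up c = R `` {c} \<inter> F" for c
  have up_closed: "closedin X (up c)" if "c \<in> F" for c
    using that FX F cl by (auto simp: up_def)
  have up_self: "c \<in> up c" if "c \<in> F" for c
    using that FX refl by (auto simp: up_def)
  have up_mono: "up d \<subseteq> up c" if "d \<in> up c" for c d
    using that trans unfolding up_def by blast
  \<comment> \<open>\<open>subset_Zorn\<close> yields maximal sets, so complements in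
    \<open>F\<close> are used: a maximal \<open>F - up c\<close> is a minimal
    \<open>up c\<close>.\<close>
  define A where "A = (\<lambda>c. F - up c) ` up x"
  have "\<exists>B\<in>A. \<forall>S\<in>C. S \<subseteq> B" if C: "subset.chain A C" for C
  proof -
    have CA: "C \<subseteq> A" and lin: "\<And>S T. S \<in> C \<Longrightarrow> T \<in> C \<Longrightarrow> S \<subseteq> T \<or> T \<subseteq> S"
      using C by (auto simp: subset_chain_def)
    \<comment> \<open>Adding \<open>up x\<close> covers the empty chain and puts the common point
      \<open>d\<close> found below into \<open>up x\<close>.\<close>
    define K where "K = insert (up x) ((\<lambda>S. F - S) ` C)"
    have KE: "\<exists>c \<in> up x. S = up c" if "S \<in> K" for S
    proof (cases "S = up x")
      case True
      then show ?thesis using up_self x by auto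
    next
      case False
      then obtain T where "T \<in> C" "S = F - T"
        using \<open>S \<in> K\<close> by (auto simp: K_def)
      then obtain c where "c \<in> up x" "S = F - (F - up c)"
        using CA by (auto simp: A_def)
      then show ?thesis
        by (auto simp: up_def)
    qed
    have Kx: "S \<subseteq> up x" if "S \<in> K" for S
      using KE[OF that] up_mono by auto
    have Klin: "S \<subseteq> T \<or> T \<subseteq> S" if ST: "S \<in> K" "T \<in> K" for S T
    proof (cases "S = up x \<or> T = up x")
      case True
      then show ?thesis using Kx ST by blast
    next
      case False
      then obtain S' T' where "S' \<in> C" "T' \<in> C" "S = F - S'" "T = F - T'"
        using ST unfolding K_def by blast
      then show ?thesis using lin[of S' T'] by blast
    qed
    \<comment> \<open>A nonempty finite chain has its intersection as a member, so the intersection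
      is some \<open>up c\<close> and contains \<open>c\<close>.\<close>
    have fip: "\<Inter>G \<noteq> {}" if G: "finite G" "G \<subseteq> K" for G
    proof (cases "G = {}")
      case True
      then show ?thesis by simp
    next
      case False
      have "subset.chain K G"
        using G Klin by (auto simp: subset_chain_def)
      then have "\<Inter>G \<in> G"
        using Inter_in_chain[of G K] G False by blast
      then obtain c where "c \<in> up x" "\<Inter>G = up c"
        using KE G by blast
      then show ?thesis
        using up_self[of c] by (auto simp: up_def)
    qed
    have "\<forall>S\<in>K. closedin X S"
      using KE up_closed by (force simp: up_def)
    then have "\<Inter>K \<noteq> {}"
      using comp fip unfolding compact_space_fip by blast
    then obtain d where d: "\<And>S. S \<in> K \<Longrightarrow> d \<in> S"
      by blast
    show ?thesis
    proof (intro bexI ballI)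
      show "F - up d \<in> A"
        using d by (auto simp: A_def K_def)
      fix S assume S: "S \<in> C"
      then obtain c where c: "c \<in> up x" "S = F - up c"
        using CA by (auto simp: A_def)
      have "d \<in> F - S"
        using d S by (auto simp: K_def)
      then have "d \<in> up c"
        using c by blast
      then show "S \<subseteq> F - up d"
        using up_mono c by blast
    qed
  qed
  from subset_Zorn[of A, OF this] obtain M where M: "M \<in> A" "\<And>S. S \<in> A \<Longrightarrow> M \<subseteq> S \<Longrightarrow> S = M"
    by blast
  then obtain y where y: "y \<in> up x" "M = F - up y"
    by (auto simp: A_def)
  have "(z, y) \<in> R" if "z \<in> F" "(y, z) \<in> R" for z
  proof -
    have z: "z \<in> up y" "z \<in> up x"
      using that y trans unfolding up_def by blast+
    then have "F - up z = F - up y"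
      using M(2)[of "F - up z"] up_mono[of z y] y by (auto simp: A_def)
    moreover have "y \<in> up y"
      using y up_self by (auto simp: up_def)
    ultimately show ?thesis
      by (auto simp: up_def)
  qed
  with y that[of y] show thesis
    by (auto simp: up_def qmax_def)
qed

section \<open>Frame relations and the quasi-order Q = ER, written \<open>R O E\<close>\<close>

locale ms4_frame =
  fixes X :: "'a topology" and R E :: "'a rel"
  assumes frame: "descriptive_ms4_frame X R E"
begin

lemma stone: "stone_space X"
  and R_preorder: "preorder_on (topspace X) R"
  and R_continuous: "continuous_rel X R"
  and E_equiv: "equiv (topspace X) E"
  and E_continuous: "continuous_rel X E"
  using frame by (auto simp: descriptive_ms4_frame_def)

lemma R_refl: "x \<in> topspace X \<Longrightarrow> (x, x) \<in> R"
  using R_preorder by (auto simp: preorder_on_def refl_on_def)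

lemma R_trans: "(x, y) \<in> R \<Longrightarrow> (y, z) \<in> R \<Longrightarrow> (x, z) \<in> R"
  using R_preorder by (auto simp: preorder_on_def dest: transD)

lemma R_dom: "(x, y) \<in> R \<Longrightarrow> x \<in> topspace X \<and> y \<in> topspace X"
  using R_continuous by (auto simp: continuous_rel_def)

lemma E_refl: "x \<in> topspace X \<Longrightarrow> (x, x) \<in> E"
  using E_equiv by (auto simp: equiv_def refl_on_def)

lemma E_sym: "(x, y) \<in> E \<Longrightarrow> (y, x) \<in> E"
  using E_equiv by (auto simp: equiv_def dest: symD)

lemma E_trans: "(x, y) \<in> E \<Longrightarrow> (y, z) \<in> E \<Longrightarrow> (x, z) \<in> E"
  using E_equiv by (auto simp: equiv_def dest: transD)

lemma E_dom: "(x, y) \<in> E \<Longrightarrow> x \<in> topspace X \<and> y \<in> topspace X"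
  using E_continuous by (auto simp: continuous_rel_def)

lemma E_R_commute:
  assumes "(x, y) \<in> E" "(y, z) \<in> R"
  obtains u where "(x, u) \<in> R" "(u, z) \<in> E"
  using assms frame by (auto simp: descriptive_ms4_frame_def)

lemma Q_dom: "(x, y) \<in> R O E \<Longrightarrow> x \<in> topspace X \<and> y \<in> topspace X"
  using R_dom E_dom by blast

lemma R_imp_Q: "(x, y) \<in> R \<Longrightarrow> (x, y) \<in> R O E"
  using R_dom E_refl by blast

lemma E_imp_Q: "(x, y) \<in> E \<Longrightarrow> (x, y) \<in> R O E"
  using E_dom R_refl by blast

text \<open>In the path R, E, R, E the inner E-then-R step is replaced by R-then-E, after which
  equal relations are adjacent and compose.\<close>

lemma Q_trans:
  assumes "(x, y) \<in> R O E" "(y, z) \<in> R O E"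
  shows "(x, z) \<in> R O E"
proof -
  obtain a b where "(x, a) \<in> R" "(a, y) \<in> E" "(y, b) \<in> R" "(b, z) \<in> E"
    using assms by blast
  moreover from this obtain u where "(a, u) \<in> R" "(u, b) \<in> E"
    using E_R_commute by blast
  ultimately show ?thesis
    using R_trans E_trans by blast
qed

lemma saturated_iff:
  "saturated X E U \<longleftrightarrow> U \<subseteq> topspace X \<and> (\<forall>x y. x \<in> U \<longrightarrow> (x, y) \<in> E \<longrightarrow> y \<in> U)"
proof
  assume "saturated X E U"
  then obtain \<C> where C: "\<C> \<subseteq> topspace X // E" "U = \<Union>\<C>"
    by (auto simp: saturated_def)
  then show "U \<subseteq> topspace X \<and> (\<forall>x y. x \<in> U \<longrightarrow> (x, y) \<in> E \<longrightarrow> y \<in> U)"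
    using E_dom E_trans unfolding quotient_def by blast
next
  assume U: "U \<subseteq> topspace X \<and> (\<forall>x y. x \<in> U \<longrightarrow> (x, y) \<in> E \<longrightarrow> y \<in> U)"
  then have "U = \<Union>((\<lambda>x. E `` {x}) ` U)"
    using E_refl by auto
  moreover have "(\<lambda>x. E `` {x}) ` U \<subseteq> topspace X // E"
    using U by (auto simp: quotient_def)
  ultimately show "saturated X E U"
    unfolding saturated_def by blast
qed

section \<open>Truth sets of formulas\<close>

lemma clopenin_truth_set:
  assumes "\<forall>n. clopenin X (v n)"
  shows "clopenin X (truth_set X R E v \<phi>)"
proof (induction \<phi>)
  case Bot
  show ?case by (simp add: clopenin_def)
next
  case (Imp \<phi> \<psi>)
  then show ?case
    by (simp add: clopenin_Un clopenin_Diff clopenin_topspace)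
next
  case (Dia \<phi>)
  then show ?case using R_continuous by (simp add: continuous_rel_def)
next
  case (Exists \<phi>)
  then show ?case using E_continuous by (simp add: continuous_rel_def)
qed (use assms in simp)

lemma truth_set_Box:
  "truth_set X R E v (Box \<phi>) = {x \<in> topspace X. \<forall>y. (x, y) \<in> R \<longrightarrow> y \<in> truth_set X R E v \<phi>}"
  by (auto simp: Box_def Neg_def dest: R_dom)

lemma truth_set_Box_Forall:
  "truth_set X R E v (Box (Forall \<phi>)) =
     {x \<in> topspace X. \<forall>y. (x, y) \<in> R O E \<longrightarrow> y \<in> truth_set X R E v \<phi>}"
  unfolding truth_set_Box Forall_def Neg_def by (auto dest: R_dom E_dom)

lemma truth_set_Box_Forall_Q:
  "x \<in> truth_set X R E v (Box (Forall \<phi>)) \<Longrightarrow> (x, y) \<in> R O E \<Longrightarrow>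
     y \<in> truth_set X R E v (Box (Forall \<phi>))"
  using Q_trans Q_dom unfolding truth_set_Box_Forall by blast

section \<open>From flatness to validity\<close>

text \<open>A step from \<open>y'\<close> to \<open>z\<close> in \<open>U\<close> commutes to y R u
  E z. Saturation puts \<open>u\<close> in \<open>U\<close>, so \<open>u\<close> returns to
  \<open>y\<close>; commuting again gives z R w E y. Now \<open>y'\<close> sees \<open>w\<close> in
  the same class, and flatness turns this around, so \<open>z\<close> sees \<open>y'\<close> through
  \<open>w\<close>.\<close>

lemma qmax_E_class:
  assumes sat: "saturated X E U" and y: "y \<in> qmax R U" and flat: "flat R (E `` {y})"
    and yy: "(y, y') \<in> E"
  shows "y' \<in> qmax R U"
proof -
  have satD: "b \<in> U" if "a \<in> U" "(a, b) \<in> E" for a b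
    using sat that saturated_iff by blast
  have "(z, y') \<in> R" if z: "z \<in> U" "(y', z) \<in> R" for z
  proof -
    obtain u where u: "(y, u) \<in> R" "(u, z) \<in> E"
      using E_R_commute yy z by blast
    then have "(u, y) \<in> R"
      using y z satD E_sym unfolding qmax_def by blast
    then obtain w where w: "(z, w) \<in> R" "(w, y) \<in> E"
      using E_R_commute u E_sym by blast
    then have "(w, y') \<in> R"
      using flat yy z R_trans E_sym unfolding flat_def by blast
    then show ?thesis
      using w R_trans by blast
  qed
  then show ?thesis
    using y yy satD unfolding qmax_def by blast
qed

lemma MpCas_if_flat:
  assumes flat: "\<And>U x. clopenin X U \<Longrightarrow> saturated X E U \<Longrightarrow> x \<in> qmax R U \<Longrightarrow> flat R (E `` {x})"
  shows "frame_valid X R E MpCas"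
  unfolding frame_valid_def
proof (intro allI impI)
  fix v :: "nat \<Rightarrow> 'a set"
  assume v: "\<forall>n. clopenin X (v n)"
  define BA where "BA = Box (Forall (Var 0))"
  define hyp where "hyp = Box (Forall (Imp (Box (Imp (Box (Var 0)) BA)) BA))"
  define B where "B = truth_set X R E v BA"
  define W where "W = truth_set X R E v hyp"
  \<comment> \<open>The points refuting the formula, so validity amounts to
    \<open>U = {}\<close>.\<close>
  define U where "U = W - B"
  have B_iff: "B = {x \<in> topspace X. \<forall>y. (x, y) \<in> R O E \<longrightarrow> y \<in> v 0}"
    by (simp add: B_def BA_def truth_set_Box_Forall)
  have B_Q: "b \<in> B" if "a \<in> B" "(a, b) \<in> R O E" for a b
    using that truth_set_Box_Forall_Q unfolding B_def BA_def by blast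
  have W_Q: "b \<in> W" if "a \<in> W" "(a, b) \<in> R O E" for a b
    using that truth_set_Box_Forall_Q unfolding W_def hyp_def by blast
  have clU: "clopenin X U"
    unfolding U_def W_def B_def by (intro clopenin_Diff clopenin_truth_set v)
  have UX: "U \<subseteq> topspace X"
    using clU clopenin_subset by blast
  have U_E: "b \<in> U" if "a \<in> U" "(a, b) \<in> E" for a b
    using that W_Q B_Q E_imp_Q E_sym unfolding U_def by blast
  have satU: "saturated X E U"
    using UX U_E saturated_iff by blast
  \<comment> \<open>Reflexivity of Q applies the antecedent at \<open>a\<close> itself: since
    \<open>a\<close> is not in \<open>B\<close>, it sees some \<open>z\<close> outside
    \<open>B\<close> where the box of p holds. Then \<open>z\<close> lies in \<open>U\<close>, so it
    sees \<open>a\<close> back and hence everything that \<open>a\<close> sees.\<close>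
  have qmax_box: "b \<in> v 0" if a: "a \<in> qmax R U" and ab: "(a, b) \<in> R" for a b
  proof -
    have aU: "a \<in> U"
      using a by (simp add: qmax_def)
    then have "a \<in> topspace X" "a \<in> W" "a \<notin> B"
      using UX by (auto simp: U_def)
    moreover have "(a, a) \<in> R O E"
      using E_imp_Q E_refl calculation(1) by blast
    ultimately have "a \<notin> truth_set X R E v (Box (Imp (Box (Var 0)) BA))"
      unfolding W_def hyp_def truth_set_Box_Forall B_def by auto
    then obtain z where az: "(a, z) \<in> R" and z: "z \<in> truth_set X R E v (Box (Var 0))" "z \<notin> B"
      using \<open>a \<in> topspace X\<close> R_dom
      unfolding truth_set_Box[where \<phi> = "Imp _ _"] truth_set.simps(3) B_def by blast
    have "z \<in> U"
      using W_Q \<open>a \<in> W\<close> az z R_imp_Q unfolding U_def by blast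
    then have "(z, b) \<in> R"
      using a az ab R_trans unfolding qmax_def by blast
    then show ?thesis
      using z unfolding truth_set_Box by simp
  qed
  have "U = {}"
  proof (rule ccontr)
    assume "U \<noteq> {}"
    then obtain x where "x \<in> U" by blast
    moreover have "compact_space X" "closedin X U"
        "\<And>a. a \<in> topspace X \<Longrightarrow> closedin X (R `` {a})"
      using stone R_continuous clU
      by (simp_all add: stone_space_def continuous_rel_def clopenin_def)
    ultimately obtain y where y: "y \<in> qmax R U"
      using exists_qmax_above[of X R U x] R_preorder by metis
    then have yU: "y \<in> U"
      by (simp add: qmax_def)
    \<comment> \<open>Failure of \<open>B\<close> at \<open>y\<close> gives a point \<open>w\<close>
      where p is false, with \<open>u\<close> in its class above \<open>y\<close>. Quasi-maximality
      passes from \<open>y\<close> up to \<open>u\<close>, then by flatness across the class to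
      \<open>w\<close>, contradicting \<open>qmax_box\<close>.\<close>
    then obtain u w where u: "(y, u) \<in> R" "(u, w) \<in> E" "w \<notin> v 0"
      using UX unfolding U_def B_iff by blast
    have "u \<notin> B"
      using u E_imp_Q unfolding B_iff by blast
    then have "u \<in> U"
      using W_Q yU u R_imp_Q unfolding U_def by blast
    then have "u \<in> qmax R U"
      using y u R_trans unfolding qmax_def by blast
    then have "w \<in> qmax R U"
      using qmax_E_class satU flat clU u by blast
    then show False
      using qmax_box[of w w] u E_dom R_refl by blast
  qed
  then show "truth_set X R E v MpCas = topspace X"
    using clopenin_subset[OF clopenin_truth_set[OF v, of BA]]
    unfolding U_def W_def B_def hyp_def BA_def MpCas_def Let_def by auto
qed

section \<open>From validity to flatness\<close>

lemma flat_if_MpCas: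
  assumes valid: "frame_valid X R E MpCas"
    and U: "clopenin X U" "saturated X E U" and x: "x \<in> qmax R U"
  shows "flat R (E `` {x})"
proof (rule ccontr)
  assume "\<not> flat R (E `` {x})"
  then obtain y z where xy: "(x, y) \<in> E" and xz: "(x, z) \<in> E" and yz: "(y, z) \<in> R" "(z, y) \<notin> R"
    by (auto simp: flat_def)
  have U_E: "b \<in> U" if "a \<in> U" "(a, b) \<in> E" for a b
    using that U(2) saturated_iff by blast
  have xU: "x \<in> U"
    using x by (simp add: qmax_def)
  have yX: "y \<in> topspace X" and zX: "z \<in> topspace X" and xX: "x \<in> topspace X"
    using xy xz E_dom by auto
  have "closedin X (R `` {z})"
    using R_continuous zX by (simp add: continuous_rel_def)
  then obtain V where V: "clopenin X V" "y \<in> V" "V \<inter> R `` {z} = {}"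
    using stone_space_separate[OF stone, of "R `` {z}" y] yX yz by auto
  \<comment> \<open>The complement of a downset, hence an upset; it contains \<open>z\<close>
    because \<open>V\<close> misses R(z), and omits \<open>y\<close> because \<open>y\<close> is in
    \<open>V\<close>.\<close>
  define D where "D = topspace X - R\<inverse> `` V"
  have clD: "clopenin X D"
    using R_continuous V unfolding D_def continuous_rel_def
    by (intro clopenin_Diff clopenin_topspace) simp
  have D_R: "b \<in> D" if "a \<in> D" "(a, b) \<in> R" for a b
    using that R_trans R_dom unfolding D_def by blast
  have zD: "z \<in> D"
    using V zX unfolding D_def by blast
  have yD: "y \<notin> D"
    using V yX R_refl unfolding D_def by blast
  define G where "G = U \<inter> R\<inverse> `` (D \<inter> U) - D"
  define P where "P = topspace X - G"
  have "clopenin X P"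
    using R_continuous unfolding P_def G_def continuous_rel_def
    by (intro clopenin_Diff clopenin_Int clopenin_topspace U clD) (simp add: clopenin_Int clD U)
  \<comment> \<open>Only \<open>Var 0\<close> occurs in the formula, so a constant valuation
    suffices.\<close>
  then have valP: "truth_set X R E (\<lambda>_. P) MpCas = topspace X"
    using valid by (simp add: frame_valid_def)
  have yG: "y \<in> G"
    using yD zD yz U_E xU xy xz unfolding G_def by blast
  define B where "B = truth_set X R E (\<lambda>_. P) (Box (Forall (Var 0)))"
  have B_iff: "B = {x \<in> topspace X. \<forall>y. (x, y) \<in> R O E \<longrightarrow> y \<in> P}"
    by (simp add: B_def truth_set_Box_Forall)
  have notB: "s \<notin> B" if "(s, y) \<in> R O E" for s
    using that yG unfolding B_iff P_def by blast
  \<comment> \<open>From x R u E s, saturation puts \<open>u\<close> in \<open>U\<close>, so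
    \<open>u\<close> sees \<open>x\<close>; then s E u R x E y.\<close>
  have see_y: "(s, y) \<in> R O E" if s: "s \<in> U" "(x, s) \<in> R O E" for s
  proof -
    obtain u where u: "(x, u) \<in> R" "(u, s) \<in> E"
      using s by blast
    then have "(u, x) \<in> R"
      using x U_E E_sym s unfolding qmax_def by blast
    then show ?thesis
      using u xy E_sym E_imp_Q R_imp_Q Q_trans by blast
  qed
  \<comment> \<open>This is the antecedent at \<open>x\<close> in contrapositive form: wherever
    \<open>B\<close> fails Q-above \<open>x\<close>, so does the boxed implication.\<close>
  have "\<exists>s. (t, s) \<in> R \<and> s \<in> truth_set X R E (\<lambda>_. P) (Box (Var 0)) \<and> s \<notin> B"
    if xt: "(x, t) \<in> R O E" and t: "t \<notin> B" for t
  proof -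
    obtain a b where ab: "(t, a) \<in> R" "(a, b) \<in> E" "b \<in> G"
      using t xt Q_dom E_dom unfolding B_iff P_def by blast
    then have "a \<in> U"
      using U_E E_sym unfolding G_def by blast
    moreover have xa: "(x, a) \<in> R O E"
      using xt ab R_imp_Q Q_trans by blast
    ultimately obtain c where c: "(a, c) \<in> R" "(c, y) \<in> E"
      using see_y by blast
    have tc: "(t, c) \<in> R"
      using ab c R_trans by blast
    show ?thesis
    \<comment> \<open>Either \<open>c\<close> satisfies the box of p and is the witness, or it sees
      a point of \<open>G\<close> and through it some \<open>d\<close> in
      \<open>D \<inter> U\<close>. The upset \<open>D\<close> is disjoint from \<open>G\<close>, so
      the box of p holds at \<open>d\<close>, while \<open>see_y\<close> keeps \<open>d\<close> out
      of \<open>B\<close>.\<close>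
    proof (cases "\<forall>g. (c, g) \<in> R \<longrightarrow> g \<in> P")
      case True
      then have "c \<in> truth_set X R E (\<lambda>_. P) (Box (Var 0))"
        using c E_dom unfolding truth_set_Box by auto
      then show ?thesis
        using tc notB c E_imp_Q by blast
    next
      case False
      then obtain g d where gd: "(c, g) \<in> R" "(g, d) \<in> R" "d \<in> D" "d \<in> U"
        using R_dom unfolding P_def G_def by blast
      have td: "(t, d) \<in> R"
        using tc gd R_trans by blast
      have "e \<in> P" if "(d, e) \<in> R" for e
        using D_R[OF \<open>d \<in> D\<close> that] that R_dom unfolding P_def G_def by blast
      then have "d \<in> truth_set X R E (\<lambda>_. P) (Box (Var 0))"
        using td R_dom unfolding truth_set_Box by auto
      moreover have "d \<notin> B"
        using notB see_y[OF \<open>d \<in> U\<close> Q_trans[OF xt R_imp_Q[OF td]]] by blast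
      ultimately show ?thesis
        using td by blast
    qed
  qed
  then have "x \<in> truth_set X R E (\<lambda>_. P)
      (Box (Forall (Imp (Box (Imp (Box (Var 0)) (Box (Forall (Var 0))))) (Box (Forall (Var 0))))))"
    using xX Q_dom B_def unfolding truth_set_Box_Forall[where \<phi> = "Imp _ _"]
      truth_set_Box[where \<phi> = "Imp _ _"] truth_set.simps(3)
    by blast
  then have "x \<in> B"
    using valP xX unfolding MpCas_def Let_def B_def by auto
  then show False
    using notB xy E_imp_Q by blast
qed

end

theorem theorem4p4:
  fixes X :: "'a topology" and R E :: "'a rel"
  assumes "descriptive_ms4_frame X R E"
  shows "frame_valid X R E MpCas \<longleftrightarrow>
    (\<forall>U. clopenin X U \<and> saturated X E U \<longrightarrow> (\<forall>x \<in> qmax R U. flat R (E `` {x})))"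
proof -
  interpret ms4_frame X R E
    using assms by unfold_locales
  show ?thesis
    using MpCas_if_flat flat_if_MpCas by blast
qed

end
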